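(* For every integer $n \geq 8$ with $n \neq 11$, Right wins the Forbidden Leaf Variant of the Mixed Deletion Game played on the cycle $C_n$ regardless of which player moves first.
   Context: The Classic Variant of the Mixed Deletion Game is a two-player combinatorial game between Left and Right played on a finite simple undirected graph; players alternate turns. On her turn Left deletes one vertex together with all edges incident to it; on his turn Right deletes one edge. The game ends when a deletion creates an isolated vertex (a vertex of degree $0$), and the player whose deletion created an isolated vertex loses; thus a legal move is a deletion which does not create an isolated vertex, and a player with no legal move loses. The Forbidden Leaf Variant has the same rules with the additional restriction that Left may not delete a leaf (a vertex of degree $1$). $C_n$ denotes the cycle graph on $n$ vertices. *)

theory Defs
  imports Main
begin

record 'a graph =
  verts :: "'a set"
  edges :: "'a set set"

definition finite_simple_graph :: "'a graph \<Rightarrow> bool" where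
  "finite_simple_graph G \<longleftrightarrow>
     finite (verts G) \<and> (\<forall>e\<in>edges G. e \<subseteq> verts G \<and> card e = 2)"

definition degree :: "'a graph \<Rightarrow> 'a \<Rightarrow> nat" where
  "degree G v = card {e \<in> edges G. v \<in> e}"

definition isolated :: "'a graph \<Rightarrow> 'a \<Rightarrow> bool" where
  "isolated G v \<longleftrightarrow> v \<in> verts G \<and> degree G v = 0"

definition leaf :: "'a graph \<Rightarrow> 'a \<Rightarrow> bool" where
  "leaf G v \<longleftrightarrow> v \<in> verts G \<and> degree G v = 1"

definition delete_vertex :: "'a graph \<Rightarrow> 'a \<Rightarrow> 'a graph" where
  "delete_vertex G v = \<lparr>verts = verts G - {v}, edges = {e \<in> edges G. v \<notin> e}\<rparr>"

definition delete_edge :: "'a graph \<Rightarrow> 'a set \<Rightarrow> 'a graph" where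
  "delete_edge G e = \<lparr>verts = verts G, edges = edges G - {e}\<rparr>"

definition creates_isolated :: "'a graph \<Rightarrow> 'a graph \<Rightarrow> bool" where
  "creates_isolated G H \<longleftrightarrow> (\<exists>w. isolated H w \<and> \<not> isolated G w)"

definition cycle_graph :: "nat \<Rightarrow> nat graph" where
  "cycle_graph n = \<lparr>verts = {0..<n}, edges = {{i, (i + 1) mod n} | i. i < n}\<rparr>"

text \<open>For \<open>n < 3\<close> the above is not a cycle (a singleton edge or a single edge arises).\<close>

lemma finite_simple_graph_cycle:
  assumes "n \<ge> 3"
  shows "finite_simple_graph (cycle_graph n)"
proof -
  have "i \<noteq> (i + 1) mod n" if "i < n" for i
    using that assms by (cases "i + 1 = n") auto
  then have "card {i, (i + 1) mod n} = 2" if "i < n" for i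
    using that by (simp add: card_2_iff)
  then show ?thesis
    using assms by (auto simp: finite_simple_graph_def cycle_graph_def)
qed

datatype player = Left | Right

fun opponent :: "player \<Rightarrow> player" where
  "opponent Left = Right"
| "opponent Right = Left"

text \<open>
  A deletion that creates an isolated vertex loses for the player making it, so such
  deletions are not legal moves, and a player without a legal move loses.
\<close>

inductive forbidden_leaf_move :: "player \<Rightarrow> 'a graph \<Rightarrow> 'a graph \<Rightarrow> bool" where
  Left: "v \<in> verts G \<Longrightarrow> \<not> leaf G v \<Longrightarrow> \<not> creates_isolated G (delete_vertex G v) \<Longrightarrow>
    forbidden_leaf_move Left G (delete_vertex G v)"
| Right: "e \<in> edges G \<Longrightarrow> \<not> creates_isolated G (delete_edge G e) \<Longrightarrow>
    forbidden_leaf_move Right G (delete_edge G e)"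

text \<open>
  \<open>wins move p q G\<close>: player \<open>p\<close> has a winning strategy from position \<open>G\<close> when \<open>q\<close> is
  to move. The second rule covers the case that the opponent has no legal move.
\<close>

inductive wins :: "(player \<Rightarrow> 'g \<Rightarrow> 'g \<Rightarrow> bool) \<Rightarrow> player \<Rightarrow> player \<Rightarrow> 'g \<Rightarrow> bool"
  for move :: "player \<Rightarrow> 'g \<Rightarrow> 'g \<Rightarrow> bool" and p :: player where
  own_move: "move p G H \<Longrightarrow> wins move p (opponent p) H \<Longrightarrow> wins move p p G"
| opponent_move: "(\<And>H. move (opponent p) G H \<Longrightarrow> wins move p p H) \<Longrightarrow>
    wins move p (opponent p) G"

end

(* Left's first move turns the cycle C_n into a path on n - 1 vertices, Right's into one on n vertices.
   From then on every position is a disjoint union of paths with at least two vertices, and only the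
   multiset of the path orders matters: Left replaces m by a, b with a + b = m - 1, Right replaces m
   by a, b with a + b = m, where a, b \<ge> 2. On a single path of order m \<ge> 2, Right wins moving
   first if m \<ge> 4, and moving second if m is not one of 5, 6, 7, 11. Since second-player wins of Right
   add up with each other and with first-player wins, the induction on the order is immediate
   whenever Left's move leaves at most one exceptional path. Among the pairs of exceptional orders,
   treated by hand, only {5, 5}, which arises from order 11, is bad for Right. *)

theory Submission
  imports Defs "HOL-Library.Multiset"
begin

section \<open>The game on multisets of path orders\<close>

text \<open>The bounds encode both rules: a part of order 1 would be an isolated vertex, and a part
  of order 0 would mean that Left deleted a leaf.\<close>

inductive split_move :: "player \<Rightarrow> nat multiset \<Rightarrow> nat multiset \<Rightarrow> bool" where
  Left: "a \<ge> 2 \<Longrightarrow> b \<ge> 2 \<Longrightarrow> split_move Left (add_mset (Suc (a + b)) A) (add_mset a (add_mset b A))"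
| Right: "a \<ge> 2 \<Longrightarrow> b \<ge> 2 \<Longrightarrow> split_move Right (add_mset (a + b) A) (add_mset a (add_mset b A))"

abbreviation right_first :: "nat multiset \<Rightarrow> bool" where
  "right_first \<equiv> wins split_move Right Right"

abbreviation right_second :: "nat multiset \<Rightarrow> bool" where
  "right_second \<equiv> wins split_move Right Left"

section \<open>Sums of positions\<close>

lemma split_move_union: "split_move p A A' \<Longrightarrow> split_move p (A + B) (A' + B)"
  by (induction rule: split_move.induct) (auto intro: split_move.intros)

lemma split_move_unionE:
  assumes "split_move p (A + B) H"
  obtains A' where "split_move p A A'" "H = A' + B" | B' where "split_move p B B'" "H = A + B'"
proof -
  have split: "(\<exists>A'. A = add_mset n A' \<and> C = A' + B) \<or> (\<exists>B'. B = add_mset n B' \<and> C = A + B')"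
    if "A + B = add_mset n C" for n C
  proof -
    have "n \<in># A \<or> n \<in># B"
      using that by (metis union_iff union_single_eq_member)
    then show ?thesis
      using that by (auto dest!: multi_member_split)
  qed
  from assms show thesis
  proof cases
    case (Left a b C)
    from split[OF Left(2)] show thesis
      using Left that split_move.Left[OF Left(4,5)] by fastforce
  next
    case (Right a b C)
    from split[OF Right(2)] show thesis
      using Right that split_move.Right[OF Right(4,5)] by fastforce
  qed
qed

lemma right_firstI: "split_move Right A B \<Longrightarrow> right_second B \<Longrightarrow> right_first A"
  using wins.own_move[of split_move Right A B] by simp

lemma right_secondI: "(\<And>B. split_move Left A B \<Longrightarrow> right_first B) \<Longrightarrow> right_second A"
  using wins.opponent_move[of split_move Right A] by simp

text \<open>Right answers in the summand in which Left has just moved. The outer induction follows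
  Right's strategy on \<open>A\<close>, the inner one his strategy on \<open>B\<close>.\<close>

lemma wins_union:
  "wins split_move Right q A \<Longrightarrow> right_second B \<Longrightarrow> wins split_move Right q (A + B)"
proof (induction arbitrary: B rule: wins.induct)
  case (own_move A A')
  then have "right_second (A' + B)" by simp
  then show ?case
    using own_move.hyps(1) by (blast intro: right_firstI split_move_union)
next
  case (opponent_move A)
  \<comment> \<open>\<open>A\<close> is now a second-player win for Right. The claim is made for
    both values of \<open>q\<close>, because a move of Left in \<open>B\<close> leaves Right to move
    there.\<close>
  have "wins split_move Right q (A + B)" if "wins split_move Right q B" for q
    using that
  proof (induction rule: wins.induct)
    case (own_move B B')
    then show ?case
      using split_move_union[of Right B B' A] by (simp add: right_firstI add.commute)
  next
    case (opponent_move B)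
    have "right_second B"
      using opponent_move.hyps by (simp add: right_secondI)
    then have "right_second (A + B)"
      using \<open>\<And>A' B. split_move (opponent Right) A A' \<Longrightarrow> right_second B \<Longrightarrow> right_first (A' + B)\<close>
        opponent_move.IH
      by (intro right_secondI) (auto elim!: split_move_unionE)
    then show ?case by simp
  qed
  with opponent_move.prems show ?case by simp
qed

lemma right_second_add: "right_second {#n#} \<Longrightarrow> right_second A \<Longrightarrow> right_second (add_mset n A)"
  using wins_union[of Left "{#n#}" A] by simp

lemma right_first_add: "right_first {#n#} \<Longrightarrow> right_second A \<Longrightarrow> right_first (add_mset n A)"
  using wins_union[of Right "{#n#}" A] by simp

lemma right_second_all: "(\<And>n. n \<in># A \<Longrightarrow> right_second {#n#}) \<Longrightarrow> right_second A"
proof (induction A)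
  case empty
  show ?case by (rule right_secondI) (auto elim: split_move.cases)
next
  case (add n A)
  then show ?case by (intro right_second_add[of n A]) simp_all
qed

lemma right_first_add_all:
  "right_first {#n#} \<Longrightarrow> (\<And>k. k \<in># A \<Longrightarrow> right_second {#k#}) \<Longrightarrow> right_first (add_mset n A)"
  by (rule right_first_add[OF _ right_second_all])

lemma right_first_split:
  "right_second (add_mset a (add_mset b A)) \<Longrightarrow> n = a + b \<Longrightarrow> a \<ge> 2 \<Longrightarrow> b \<ge> 2 \<Longrightarrow>
    right_first (add_mset n A)"
  using split_move.Right right_firstI by blast

text \<open>The two parts are interchangeable in a multiset, so it suffices to check Left's moves
  with \<open>a \<le> b\<close>.\<close>

lemma right_second_split:
  assumes "\<And>n a b. n \<in># M \<Longrightarrow> n = Suc (a + b) \<Longrightarrow> a \<ge> 2 \<Longrightarrow> a \<le> b \<Longrightarrow>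
    right_first (add_mset a (add_mset b (M - {#n#})))"
  shows "right_second M"
proof (rule right_secondI)
  fix B assume "split_move Left M B"
  then show "right_first B"
  proof cases
    case (Left a b A)
    then show ?thesis
      using assms[of "Suc (a + b)" a b] assms[of "Suc (a + b)" b a]
      by (cases "a \<le> b") (auto simp: add_mset_commute)
  qed
qed

section \<open>Single paths of small order\<close>

lemma right_second_single:
  assumes "\<And>a b. n = Suc (a + b) \<Longrightarrow> a \<ge> 2 \<Longrightarrow> a \<le> b \<Longrightarrow> right_first {#a, b#}"
  shows "right_second {#n#}"
  using assms by (intro right_second_split) auto

text \<open>Left needs order at least 2 + 1 + 2 = 5 to move, so she loses at once.\<close>

lemma right_second_2_3_4: "right_second {#2#}" "right_second {#3#}" "right_second {#4#}"
  by (rule right_second_single; simp)+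

text \<open>Each of these orders is a sum of two numbers from 2, 3, 4, and after that cut Left
  cannot move.\<close>

lemma right_first_4_5_6_7:
  "right_first {#4#}" "right_first {#5#}" "right_first {#6#}" "right_first {#7#}"
proof -
  have *: "right_first {#n#}" if "n = a + b" "a \<in> {2, 3, 4}" "b \<in> {2, 3, 4}" for n a b
    by (rule right_first_split[OF right_second_all that(1)])
      (use that right_second_2_3_4 in auto)
  show "right_first {#4#}" "right_first {#5#}" "right_first {#6#}" "right_first {#7#}"
    using *[of 4 2 2] *[of 5 2 3] *[of 6 2 4] *[of 7 3 4] by simp_all
qed

text \<open>Left's moves on the orders 4 to 11; the sums are smaller by one because of the deleted
  vertex.\<close>

lemma ordered_splits:
  fixes a b :: nat
  shows "a + b = 3 \<Longrightarrow> a \<ge> 2 \<Longrightarrow> a \<le> b \<Longrightarrow> False"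
    and "a + b = 4 \<Longrightarrow> a \<ge> 2 \<Longrightarrow> a \<le> b \<Longrightarrow> a = 2 \<and> b = 2"
    and "a + b = 5 \<Longrightarrow> a \<ge> 2 \<Longrightarrow> a \<le> b \<Longrightarrow> a = 2 \<and> b = 3"
    and "a + b = 6 \<Longrightarrow> a \<ge> 2 \<Longrightarrow> a \<le> b \<Longrightarrow> a = 2 \<and> b = 4 \<or> a = 3 \<and> b = 3"
    and "a + b = 7 \<Longrightarrow> a \<ge> 2 \<Longrightarrow> a \<le> b \<Longrightarrow> a = 2 \<and> b = 5 \<or> a = 3 \<and> b = 4"
    and "a + b = 8 \<Longrightarrow> a \<ge> 2 \<Longrightarrow> a \<le> b \<Longrightarrow>
      a = 2 \<and> b = 6 \<or> a = 3 \<and> b = 5 \<or> a = 4 \<and> b = 4"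
    and "a + b = 9 \<Longrightarrow> a \<ge> 2 \<Longrightarrow> a \<le> b \<Longrightarrow>
      a = 2 \<and> b = 7 \<or> a = 3 \<and> b = 6 \<or> a = 4 \<and> b = 5"
    and "a + b = 10 \<Longrightarrow> a \<ge> 2 \<Longrightarrow> a \<le> b \<Longrightarrow>
      a = 2 \<and> b = 8 \<or> a = 3 \<and> b = 7 \<or> a = 4 \<and> b = 6 \<or> a = 5 \<and> b = 5"
  by presburger+

text \<open>Every move of Left leaves one part among 2, 3, 4, a second-player win, and one among 4,
  5, 6, 7, where Right starts.\<close>

lemma right_second_8_9_10: "right_second {#8#}" "right_second {#9#}" "right_second {#10#}"
proof -
  have *: "right_first {#k, n#}" if "right_second {#k#}" "right_first {#n#}" for k n
    using right_first_add[OF that(2,1)] by (simp add: add_mset_commute)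
  note right_first = *[OF right_second_2_3_4(1)] *[OF right_second_2_3_4(2)]
    *[OF right_second_2_3_4(3)] right_first_4_5_6_7
  show "right_second {#8#}" by (rule right_second_single) (auto dest!: ordered_splits intro: right_first)
  show "right_second {#9#}" by (rule right_second_single) (auto dest!: ordered_splits intro: right_first)
  show "right_second {#10#}" by (rule right_second_single) (auto dest!: ordered_splits intro: right_first)
qed

lemma right_first_8: "right_first {#8#}"
  by (rule right_first_split[of 4 4, OF right_second_all]) (use right_second_2_3_4 in auto)

lemma right_first_11: "right_first {#11#}"
  by (rule right_first_split[of 2 9, OF right_second_all])
    (use right_second_2_3_4 right_second_8_9_10 in auto)

text \<open>A path of order 4 is a spare move for Right: Left cannot touch it, while Right can cut
  it into 2 + 2. Left has to break the exceptional partner into parts from 2, 3, 4, and Right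
  replies on the 4.\<close>

lemma right_second_4_567:
  "right_second {#4, 5#}" "right_second {#4, 6#}" "right_second {#4, 7#}"
proof -
  have *: "right_first {#a, b, 4#}" if "a \<in> {2, 3, 4}" "b \<in> {2, 3, 4}" for a b
    using right_first_add_all[OF right_first_4_5_6_7(1), of "{#a, b#}"] right_second_2_3_4 that
    by (auto simp: add_mset_commute)
  show "right_second {#4, 5#}" "right_second {#4, 6#}" "right_second {#4, 7#}"
    by (rule right_second_split; auto dest: ordered_splits intro: *)+
qed

lemma right_second_4_11: "right_second {#4, 11#}"
proof (rule right_second_split)
  fix n a b assume "n \<in># {#4, 11#}" "n = Suc (a + b)" "a \<ge> 2" "a \<le> b"
  then have n: "n = 11" and ab: "a = 2 \<and> b = 8 \<or> a = 3 \<and> b = 7 \<or> a = 4 \<and> b = 6 \<or> a = 5 \<and> b = 5"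
    by (auto dest: ordered_splits)
  \<comment> \<open>The split into 5 and 5 is the critical one: Right cuts one 5 into 2 + 3, and the
    other 5 stays paired with the 4.\<close>
  have "right_first {#5, 4, 5#}"
    using right_second_add[OF right_second_2_3_4(1) right_second_add[OF right_second_2_3_4(2)]]
      right_second_4_567(1)
    by (intro right_first_split[of 2 3]) simp_all
  moreover have "right_first {#8, 2, 4#}" "right_first {#7, 3, 4#}" "right_first {#6, 4, 4#}"
    by (rule right_first_add_all;
        use right_first_4_5_6_7 right_first_8 right_second_2_3_4 in auto)+
  ultimately show "right_first (add_mset a (add_mset b ({#4, 11#} - {#n#})))"
    using n ab by (auto simp: add_mset_commute)
qed

text \<open>Arises when Right cuts 11 into 4 + 7 next to a 5. Whichever of 5 and 7 Left breaks, only
  parts from 2, 3, 4 result, and Right starts on the other one.\<close>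

lemma right_second_4_5_7: "right_second {#4, 5, 7#}"
proof (rule right_second_split)
  fix n a b assume "n \<in># {#4, 5, 7#}" "n = Suc (a + b)" "a \<ge> 2" "a \<le> b"
  then have "n = 5 \<and> a = 2 \<and> b = 2 \<or> n = 7 \<and> (a = 2 \<and> b = 4 \<or> a = 3 \<and> b = 3)"
    by (auto dest: ordered_splits)
  moreover have "right_first {#7, 4, 2, 2#}" "right_first {#5, 4, 2, 4#}" "right_first {#5, 4, 3, 3#}"
    by (rule right_first_add_all; use right_first_4_5_6_7 right_second_2_3_4 in auto)+
  ultimately show "right_first (add_mset a (add_mset b ({#4, 5, 7#} - {#n#})))"
    by (auto simp: add_mset_commute)
qed

text \<open>Arises from two paths of order 11 when Right cuts one of them into 4 + 7.\<close>

lemma right_second_4_7_11: "right_second {#4, 7, 11#}"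
proof (rule right_second_split)
  fix n a b assume "n \<in># {#4, 7, 11#}" "n = Suc (a + b)" "a \<ge> 2" "a \<le> b"
  then have "n = 7 \<and> (a = 2 \<and> b = 4 \<or> a = 3 \<and> b = 3) \<or>
      n = 11 \<and> (a = 2 \<and> b = 8 \<or> a = 3 \<and> b = 7 \<or> a = 4 \<and> b = 6 \<or> a = 5 \<and> b = 5)"
    by (auto dest: ordered_splits)
  moreover have "right_first {#11, 2, 4, 4#}" "right_first {#11, 3, 3, 4#}"
      "right_first {#7, 2, 8, 4#}"
    by (rule right_first_add_all;
        use right_first_4_5_6_7 right_first_11 right_second_2_3_4 right_second_8_9_10 in auto)+
  \<comment> \<open>Right starts on a 7 or on the 6; what remains is the second-player win 4, 7
    together with a 3 or a 4.\<close>
  moreover have "right_first {#7, 3, 4, 7#}" "right_first {#6, 4, 4, 7#}"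
    using right_first_add[OF right_first_4_5_6_7(4)]
      right_first_add[OF right_first_4_5_6_7(3)]
      right_second_add[OF right_second_2_3_4(2) right_second_4_567(3)]
      right_second_add[OF right_second_2_3_4(3) right_second_4_567(3)]
    by simp_all
  \<comment> \<open>Cutting 7 into 3 + 4 provides a second 4, so that each 5 has its own
    partner.\<close>
  moreover have "right_first {#7, 5, 4, 5#}"
    using right_second_add[OF right_second_2_3_4(2) wins_union[OF right_second_4_567(1,1)]]
    by (intro right_first_split[of 3 4]) (simp_all add: add_mset_commute)
  ultimately show "right_first (add_mset a (add_mset b ({#4, 7, 11#} - {#n#})))"
    by (auto simp: add_mset_commute)
qed

text \<open>Right's cut always produces a 4: 6 = 2 + 4, 7 = 3 + 4, 11 = 4 + 7. From the pair 5, 5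
  this is impossible, as 5 can only be cut into 2 + 3.\<close>

lemma right_first_exceptional_pair:
  assumes "a \<in> {5, 6, 7, 11}" "b \<in> {5, 6, 7, 11}" "(a, b) \<noteq> (5, 5)"
  shows "right_first {#a, b#}"
proof -
  have six: "right_first {#6, n#}" if "right_second {#4, n#}" for n
    using right_second_add[OF right_second_2_3_4(1) that]
    by (intro right_first_split[of 2 4]) simp_all
  have seven: "right_first {#7, n#}" if "right_second {#4, n#}" for n
    using right_second_add[OF right_second_2_3_4(2) that]
    by (intro right_first_split[of 3 4]) simp_all
  have eleven: "right_first {#11, n#}" if "right_second {#4, 7, n#}" for n
    using that by (intro right_first_split[of 4 7]) simp_all
  note six[OF right_second_4_567(1)] six[OF right_second_4_567(2)] six[OF right_second_4_567(3)]
    six[OF right_second_4_11] seven[OF right_second_4_567(1)] seven[OF right_second_4_567(3)]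
    seven[OF right_second_4_11] eleven[of 5] eleven[of 11]
  then show ?thesis
    using assms right_second_4_5_7 right_second_4_7_11 by (auto simp: add_mset_commute)
qed

text \<open>The two claims need each other: Right's first cut has to leave second-player wins, and
  his answer to Left is a first move on a smaller path.\<close>

lemma single_path:
  "(n \<ge> 4 \<longrightarrow> right_first {#n#}) \<and> (n \<ge> 2 \<longrightarrow> n \<notin> {5, 6, 7, 11} \<longrightarrow> right_second {#n#})"
proof (induction n rule: less_induct)
  case (less n)
  have second: "right_second {#k#}" if "k < n" "k \<ge> 2" "k \<notin> {5, 6, 7, 11}" for k
    using less that by blast
  have first: "right_first {#k#}" if "k < n" "k \<ge> 4" for k
    using less that by blast
  have "right_first {#n#}" if "n \<ge> 4"
  proof -
    have "n = 4 \<or> n = 5 \<or> n = 6 \<or> n = 7 \<or> n = 8 \<or> n = 11 \<or> n = 9 \<or> n = 13 \<or>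
        n = 10 \<or> n = 12 \<or> n \<ge> 14"
      using that by presburger
    then consider "n \<in> {4, 5, 6, 7, 8, 11}" | "n = 9" | "n = 13" | "n = 10 \<or> n = 12 \<or> n \<ge> 14"
      by blast
    then show ?thesis
    proof cases
      case 1
      then show ?thesis using right_first_4_5_6_7 right_first_8 right_first_11 by auto
    next
      case 2
      then show ?thesis using right_second_4_567 by (intro right_first_split[of 4 5]) auto
    next
      case 3
      then show ?thesis
        by (intro right_first_split[of 3 10, OF right_second_all])
          (use right_second_2_3_4 right_second_8_9_10 in auto)
    next
      case 4
      then have "right_second {#n - 2#}" by (intro second) auto
      with 4 show ?thesis
        by (intro right_first_split[of 2 "n - 2", OF right_second_all])
          (use right_second_2_3_4 in auto)
    qed
  qed
  moreover have "right_second {#n#}" if "n \<ge> 2" "n \<notin> {5, 6, 7, 11}"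
  proof (rule right_second_single)
    fix a b assume ab: "n = Suc (a + b)" "a \<ge> 2" "a \<le> b"
    \<comment> \<open>A move of Left with larger part at most 3 exists only on the orders 5, 6, 7.
      So Right can start on \<open>b\<close> whenever \<open>a\<close> is a second-player
      win.\<close>
    then have "b \<ge> 4" using that by auto
    consider "a \<notin> {5, 6, 7, 11}" | "a \<in> {5, 6, 7, 11}" "b \<notin> {5, 6, 7, 11}"
      | "a \<in> {5, 6, 7, 11}" "b \<in> {5, 6, 7, 11}" by blast
    then show "right_first {#a, b#}"
    proof cases
      case 1
      have "right_first {#b, a#}"
        by (rule right_first_add[OF first second]) (use 1 ab \<open>b \<ge> 4\<close> in auto)
      then show ?thesis by (simp add: add_mset_commute)
    next
      case 2
      show ?thesis by (rule right_first_add[OF first second]) (use 2 ab in auto)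
    next
      case 3
      \<comment> \<open>The pair 5, 5 would give n = 11, which is excluded.\<close>
      show ?thesis by (rule right_first_exceptional_pair) (use 3 ab that in auto)
    qed
  qed
  ultimately show ?case by blast
qed

section \<open>Disjoint unions of paths\<close>

fun path_edges :: "'a list \<Rightarrow> 'a set set" where
  "path_edges [] = {}"
| "path_edges [x] = {}"
| "path_edges (x # y # xs) = insert {x, y} (path_edges (y # xs))"

lemma path_edges_Cons: "xs \<noteq> [] \<Longrightarrow> path_edges (x # xs) = insert {x, hd xs} (path_edges xs)"
  by (cases xs) auto

lemma path_edges_append:
  "xs \<noteq> [] \<Longrightarrow> ys \<noteq> [] \<Longrightarrow>
    path_edges (xs @ ys) = insert {last xs, hd ys} (path_edges xs \<union> path_edges ys)"
  by (induction xs rule: path_edges.induct) (auto simp: path_edges_Cons)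

lemma path_edges_subset: "e \<in> path_edges xs \<Longrightarrow> e \<subseteq> set xs"
  by (induction xs rule: path_edges.induct) auto

lemma finite_path_edges: "finite (path_edges xs)"
  by (induction xs rule: path_edges.induct) auto

lemma path_edges_cover: "length xs \<ge> 2 \<Longrightarrow> x \<in> set xs \<Longrightarrow> \<exists>e\<in>path_edges xs. x \<in> e"
proof (induction xs rule: path_edges.induct)
  case (3 y z xs)
  then show ?case by (cases xs) auto
qed auto

lemma path_edges_upt: "path_edges [a..<b] = (\<lambda>i. {i, Suc i}) ` {i. a \<le> i \<and> Suc i < b}"
proof (induction b)
  case (Suc b)
  show ?case
  proof (cases "a < b")
    case True
    then have "path_edges [a..<Suc b] = insert {b - 1, b} (path_edges [a..<b])"
      by (simp add: path_edges_append last_upt)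
    moreover have "{i. a \<le> i \<and> Suc i < Suc b} = insert (b - 1) {i. a \<le> i \<and> Suc i < b}"
      using True by auto
    ultimately show ?thesis using True Suc by simp
  next
    case False
    then have "{i. a \<le> i \<and> Suc i < Suc b} = {}" by auto
    moreover have "path_edges [a..<Suc b] = {}"
      using False by (cases "a = b") auto
    ultimately show ?thesis by simp
  qed
qed simp

section \<open>Multisets of vertex-disjoint paths\<close>

definition path_union :: "'a list multiset \<Rightarrow> 'a graph" where
  "path_union M = \<lparr>verts = (\<Union>xs\<in>set_mset M. set xs), edges = (\<Union>xs\<in>set_mset M. path_edges xs)\<rparr>"

text \<open>Quantifying over all ways of removing one occurrence states disjointness without indices
  and also excludes repeated lists.\<close>

definition path_system :: "'a list multiset \<Rightarrow> bool" where
  "path_system M \<longleftrightarrow> (\<forall>xs\<in>#M. length xs \<ge> 2 \<and> distinct xs) \<and>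
    (\<forall>xs N. M = add_mset xs N \<longrightarrow> set xs \<inter> verts (path_union N) = {})"

lemma path_union_add_mset:
  "verts (path_union (add_mset xs M)) = set xs \<union> verts (path_union M)"
  "edges (path_union (add_mset xs M)) = path_edges xs \<union> edges (path_union M)"
  by (auto simp: path_union_def)

lemma path_system_add_mset:
  "path_system (add_mset xs M) \<longleftrightarrow>
    length xs \<ge> 2 \<and> distinct xs \<and> set xs \<inter> verts (path_union M) = {} \<and> path_system M"
  (is "?lhs \<longleftrightarrow> ?rhs")
proof
  assume lhs: ?lhs
  have "set ys \<inter> verts (path_union N) = {}" if "M = add_mset ys N" for ys N
  proof -
    have "set ys \<inter> verts (path_union (add_mset xs N)) = {}"
      using lhs that unfolding path_system_def by (metis add_mset_commute)
    then show ?thesis by (auto simp: path_union_add_mset)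
  qed
  with lhs show ?rhs by (auto simp: path_system_def)
next
  assume rhs: ?rhs
  have "set ys \<inter> verts (path_union N) = {}" if "add_mset xs M = add_mset ys N" for ys N
  proof (cases "xs = ys")
    case False
    with that obtain K where "M = add_mset ys K" "N = add_mset xs K"
      by (auto simp: add_eq_conv_ex)
    moreover from this rhs have "set ys \<inter> verts (path_union K) = {}"
      unfolding path_system_def by blast
    ultimately show ?thesis using rhs by (auto simp: path_union_add_mset)
  qed (use rhs that in auto)
  with rhs show ?lhs by (simp add: path_system_def)
qed

section \<open>Legal moves on disjoint unions of paths\<close>

lemma edges_path_union_subset: "e \<in> edges (path_union M) \<Longrightarrow> e \<subseteq> verts (path_union M)"
  using path_edges_subset by (fastforce simp: path_union_def)

lemma finite_edges_path_union: "finite (edges (path_union M))"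
  by (auto simp: path_union_def finite_path_edges)

text \<open>\<open>degree\<close> is a \<open>card\<close>, which is 0 for infinite sets too;
  finiteness makes degree 0 mean that no edge is incident.\<close>

lemma isolated_iff:
  "finite (edges G) \<Longrightarrow> isolated G v \<longleftrightarrow> v \<in> verts G \<and> (\<forall>e\<in>edges G. v \<notin> e)"
  by (auto simp: isolated_def degree_def)

text \<open>Every list has at least two vertices, so each vertex has a neighbour on its path. Hence
  a move from a path system creates an isolated vertex as soon as the new graph has one.\<close>

lemma not_isolated_path_union:
  assumes "path_system M"
  shows "\<not> isolated (path_union M) v"
proof
  assume "isolated (path_union M) v"
  then have v: "v \<in> verts (path_union M)" and no_edge: "\<forall>e\<in>edges (path_union M). v \<notin> e"
    by (simp_all add: isolated_iff finite_edges_path_union)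
  from v obtain xs where "xs \<in># M" "v \<in> set xs" by (auto simp: path_union_def)
  with assms obtain e where "e \<in> path_edges xs" "v \<in> e"
    using path_edges_cover[of xs v] by (auto simp: path_system_def)
  with no_edge \<open>xs \<in># M\<close> show False by (auto simp: path_union_def)
qed

text \<open>Right's strategy plays only such cuts, so their legality suffices; for Left every legal
  move has to be analysed.\<close>

lemma right_split_path:
  assumes "path_system (add_mset (xs @ ys) M)" "length xs \<ge> 2" "length ys \<ge> 2"
  shows "path_system (add_mset xs (add_mset ys M))"
    and "forbidden_leaf_move Right (path_union (add_mset (xs @ ys) M))
      (path_union (add_mset xs (add_mset ys M)))"
proof -
  let ?G = "path_union (add_mset (xs @ ys) M)" and ?H = "path_union (add_mset xs (add_mset ys M))"
  let ?e = "{last xs, hd ys}"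
  from assms have ne: "xs \<noteq> []" "ys \<noteq> []" by auto
  from assms have disj: "set xs \<inter> set ys = {}" "(set xs \<union> set ys) \<inter> verts (path_union M) = {}"
    by (auto simp: path_system_add_mset)
  show system: "path_system (add_mset xs (add_mset ys M))"
    using assms by (auto simp: path_system_add_mset path_union_add_mset)
  have "last xs \<in> set xs" "hd ys \<in> set ys" using ne by auto
  \<comment> \<open>By disjointness the joining edge lies in none of the other edge sets, so these
    survive its deletion unchanged.\<close>
  then have "?e \<notin> path_edges xs" "?e \<notin> path_edges ys" "?e \<notin> edges (path_union M)"
    using disj path_edges_subset[of ?e xs] path_edges_subset[of ?e ys]
      edges_path_union_subset[of ?e M]
    by auto
  then have "delete_edge ?G ?e = ?H"
    using ne by (auto simp: delete_edge_def path_union_add_mset path_edges_append intro!: graph.equality)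
  moreover have "?e \<in> edges ?G"
    using ne by (simp add: path_union_add_mset path_edges_append)
  ultimately show "forbidden_leaf_move Right ?G ?H"
    using forbidden_leaf_move.Right[of ?e ?G] not_isolated_path_union[OF system]
    by (auto simp: creates_isolated_def)
qed

text \<open>\<open>xs\<close> and \<open>ys\<close> may be empty or have one vertex here, so that
  every deletion by Left is covered before its legality is examined.\<close>

lemma delete_vertex_path_union:
  assumes "path_system (add_mset (xs @ v # ys) M)"
  shows "delete_vertex (path_union (add_mset (xs @ v # ys) M)) v =
    path_union (add_mset xs (add_mset ys M))"
proof -
  have disj: "v \<notin> set xs" "v \<notin> set ys" "v \<notin> verts (path_union M)"
    using assms by (auto simp: path_system_add_mset)
  then have "\<And>e. e \<in> path_edges xs \<Longrightarrow> v \<notin> e" "\<And>e. e \<in> path_edges ys \<Longrightarrow> v \<notin> e"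
    "\<And>e. e \<in> edges (path_union M) \<Longrightarrow> v \<notin> e"
    using path_edges_subset edges_path_union_subset by blast+
  then show ?thesis
    using disj
    by (cases "xs = []"; cases "ys = []")
      (auto simp: delete_vertex_def path_union_add_mset path_edges_append path_edges_Cons
        intro!: graph.equality)
qed

lemma path_edges_rev: "path_edges (rev xs) = path_edges xs"
proof (induction xs)
  case (Cons x xs)
  then show ?case
    by (cases "xs = []") (simp_all add: path_edges_append path_edges_Cons last_rev insert_commute)
qed simp

text \<open>Reversal exchanges the two sides of a deleted vertex, which lets a bound for the left
  side serve for the right side as well.\<close>

lemma path_union_rev: "path_union (add_mset (rev xs) M) = path_union (add_mset xs M)"
  by (auto simp: path_union_add_mset path_edges_rev intro!: graph.equality)

lemma path_system_rev: "path_system (add_mset (rev xs) M) \<longleftrightarrow> path_system (add_mset xs M)"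
  by (simp add: path_system_add_mset)

lemma leaf_path_union:
  assumes "path_system (add_mset (v # ys) M)"
  shows "leaf (path_union (add_mset (v # ys) M)) v"
proof -
  have "ys \<noteq> []" using assms by (auto simp: path_system_add_mset)
  have "v \<notin> set ys" "v \<notin> verts (path_union M)"
    using assms by (auto simp: path_system_add_mset)
  then have "\<And>e. e \<in> path_edges ys \<Longrightarrow> v \<notin> e" "\<And>e. e \<in> edges (path_union M) \<Longrightarrow> v \<notin> e"
    using path_edges_subset edges_path_union_subset by blast+
  then have "{e \<in> edges (path_union (add_mset (v # ys) M)). v \<in> e} = {{v, hd ys}}"
    using \<open>ys \<noteq> []\<close> by (auto simp: path_union_add_mset path_edges_Cons)
  then show ?thesis
    by (simp add: leaf_def degree_def path_union_add_mset)
qed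

lemma isolated_singleton_path_union:
  assumes "w \<notin> set ys" "w \<notin> verts (path_union M)"
  shows "isolated (path_union (add_mset [w] (add_mset ys M))) w"
proof -
  have "w \<notin> e" if "e \<in> path_edges ys \<or> e \<in> edges (path_union M)" for e
    using that assms path_edges_subset[of e ys] edges_path_union_subset[of e M] by blast
  then show ?thesis
    by (simp add: isolated_iff[OF finite_edges_path_union]) (auto simp: path_union_add_mset)
qed

text \<open>An empty \<open>xs\<close> would make \<open>v\<close> a leaf, and a single vertex in
  \<open>xs\<close> would become isolated.\<close>

lemma left_legal_length:
  assumes system: "path_system (add_mset (xs @ v # ys) M)"
    and leaf: "\<not> leaf (path_union (add_mset (xs @ v # ys) M)) v"
    and legal: "\<not> creates_isolated (path_union (add_mset (xs @ v # ys) M))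
      (path_union (add_mset xs (add_mset ys M)))"
  shows "length xs \<ge> 2"
proof (rule ccontr)
  assume "\<not> length xs \<ge> 2"
  then consider "xs = []" | w where "xs = [w]"
    by (cases xs rule: path_edges.cases) auto
  then show False
  proof cases
    case 1
    then show False using leaf_path_union system leaf by fastforce
  next
    case 2
    then have "isolated (path_union (add_mset xs (add_mset ys M))) w"
      using system isolated_singleton_path_union[of w ys M]
      by (auto simp: path_system_add_mset)
    then show False
      using legal not_isolated_path_union[OF system] by (auto simp: creates_isolated_def)
  qed
qed

lemma left_split_path:
  assumes system: "path_system M" and "forbidden_leaf_move Left (path_union M) H"
  obtains xs v ys N where "M = add_mset (xs @ v # ys) N" "length xs \<ge> 2" "length ys \<ge> 2"
    "path_system (add_mset xs (add_mset ys N))" "H = path_union (add_mset xs (add_mset ys N))"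
proof -
  from assms(2) show thesis
  proof cases
    case (Left v)
    from Left(2) obtain zs where "zs \<in># M" "v \<in> set zs" by (auto simp: path_union_def)
    then obtain xs ys N where M: "M = add_mset (xs @ v # ys) N"
      by (metis mset_add split_list)
    have H: "H = path_union (add_mset xs (add_mset ys N))"
      using Left delete_vertex_path_union system M by fastforce
    have xs: "length xs \<ge> 2"
      using left_legal_length[of xs v ys N] system Left H unfolding M by simp
    have "path_union (add_mset xs (add_mset ys N)) =
        path_union (add_mset (rev ys) (add_mset (rev xs) N))"
      by (metis path_union_rev add_mset_commute)
    then have "length (rev ys) \<ge> 2"
      using left_legal_length[of "rev ys" v "rev xs" N] system Left H
        path_system_rev[of "xs @ v # ys" N] path_union_rev[of "xs @ v # ys" N]
      unfolding M by simp
    moreover have "path_system (add_mset xs (add_mset ys N))"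
      using system xs calculation unfolding M
      by (auto simp: path_system_add_mset path_union_add_mset)
    ultimately show thesis using that M H xs by auto
  qed
qed

text \<open>A one-sided simulation: Right's moves on orders are lifted to the graph, and Left's
  moves on the graph are projected to orders.\<close>

lemma wins_path_union:
  assumes "wins split_move Right q (image_mset length M)" "path_system M"
  shows "wins forbidden_leaf_move Right q (path_union M)"
  using assms
proof (induction "image_mset length M" arbitrary: M rule: wins.induct)
  case (own_move H)
  from own_move.hyps(1) show ?case
  proof cases
    case (Right a b A)
    then obtain xs N where M: "M = add_mset xs N" "length xs = a + b" "A = image_mset length N"
      by (metis msed_map_invR)
    let ?N = "add_mset (take a xs) (add_mset (drop a xs) N)"
    have "path_system ?N" "forbidden_leaf_move Right (path_union M) (path_union ?N)"
      using right_split_path[of "take a xs" "drop a xs" N] own_move.prems M Right by auto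
    moreover have "H = image_mset length ?N"
      using Right M by simp
    ultimately show ?thesis
      using own_move.hyps(3) by (blast intro: wins.own_move)
  qed
next
  case opponent_move
  show ?case
  proof (rule wins.opponent_move)
    fix H assume "forbidden_leaf_move (opponent Right) (path_union M) H"
    then have "forbidden_leaf_move Left (path_union M) H" by simp
    from left_split_path[OF opponent_move.prems this] obtain xs v ys N where
      *: "M = add_mset (xs @ v # ys) N" "length xs \<ge> 2" "length ys \<ge> 2"
      "path_system (add_mset xs (add_mset ys N))" "H = path_union (add_mset xs (add_mset ys N))"
      by blast
    then have "split_move (opponent Right) (image_mset length M)
        (image_mset length (add_mset xs (add_mset ys N)))"
      using split_move.Left[of "length xs" "length ys"] by simp
    then show "wins forbidden_leaf_move Right Right H"
      using opponent_move.hyps(2) * by blast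
  qed
qed

section \<open>The first move on the cycle\<close>

text \<open>Separates the wrap-around edge, the only one at which \<open>mod\<close>
  matters.\<close>

lemma cycle_edges:
  assumes "n \<ge> 3"
  shows "edges (cycle_graph n) = insert {n - 1, 0} ((\<lambda>i. {i, Suc i}) ` {i. Suc i < n})"
proof -
  have "edges (cycle_graph n) = (\<lambda>i. {i, (i + 1) mod n}) ` {i. i < n}"
    unfolding cycle_graph_def by auto
  also have "{i. i < n} = insert (n - 1) {i. Suc i < n}"
    using assms by auto
  also have "(\<lambda>i. {i, (i + 1) mod n}) ` \<dots> =
      insert {n - 1, 0} ((\<lambda>i. {i, (i + 1) mod n}) ` {i. Suc i < n})"
    using assms by simp
  also have "(\<lambda>i. {i, (i + 1) mod n}) ` {i. Suc i < n} = (\<lambda>i. {i, Suc i}) ` {i. Suc i < n}"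
    by (rule image_cong) simp_all
  finally show ?thesis .
qed

lemma delete_edge_cycle:
  assumes "n \<ge> 3"
  shows "delete_edge (cycle_graph n) {n - 1, 0} = path_union {#[0..<n]#}"
proof -
  \<comment> \<open>For n = 2 the wrap-around edge would coincide with the edge from 0 to 1; from n
    = 3 on it is a separate edge.\<close>
  have "{n - 1, 0} \<notin> (\<lambda>i. {i, Suc i}) ` {i. Suc i < n}"
    using assms by (auto simp: doubleton_eq_iff)
  then show ?thesis
    unfolding delete_edge_def cycle_edges[OF assms]
    by (simp add: path_union_def path_edges_upt) (simp add: cycle_graph_def)
qed

text \<open>The remaining path is read off by walking round the cycle from the successor of
  \<open>v\<close>, through the edge from n - 1 to 0, to the predecessor of
  \<open>v\<close>.\<close>

lemma delete_vertex_cycle: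
  assumes "n \<ge> 3" "v < n"
  shows "delete_vertex (cycle_graph n) v = path_union {#[Suc v..<n] @ [0..<v]#}"
proof -
  let ?f = "\<lambda>i. {i, Suc i}"
  have "{e \<in> ?f ` S. v \<notin> e} = ?f ` {i \<in> S. v \<notin> ?f i}" for S by auto
  moreover have "{i \<in> {i. Suc i < n}. v \<notin> ?f i} = {i. Suc v \<le> i \<and> Suc i < n} \<union> {i. 0 \<le> i \<and> Suc i < v}"
    using assms by auto
  ultimately have filter: "{e \<in> ?f ` {i. Suc i < n}. v \<notin> e} =
      path_edges [Suc v..<n] \<union> path_edges [0..<v]"
    by (simp only: path_edges_upt image_Un)
  have cycle: "{e \<in> edges (cycle_graph n). v \<notin> e} =
      (if v = 0 \<or> Suc v = n then {} else {{n - 1, 0}}) \<union> {e \<in> ?f ` {i. Suc i < n}. v \<notin> e}"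
    using assms unfolding cycle_edges[OF assms(1)] by auto
  have "path_edges ([Suc v..<n] @ [0..<v]) = {e \<in> edges (cycle_graph n). v \<notin> e}"
  proof (cases "v = 0 \<or> Suc v = n")
    \<comment> \<open>Here the wrap-around edge has gone with \<open>v\<close>, and one of the two
      lists is empty, so that no edge joins them.\<close>
    case True
    then show ?thesis unfolding cycle filter by auto
  next
    case False
    then have "[Suc v..<n] \<noteq> []" "[0..<v] \<noteq> []" "last [Suc v..<n] = n - 1" "hd [0..<v] = 0"
      using assms by (simp_all add: last_upt)
    then show ?thesis
      using False unfolding cycle filter by (simp add: path_edges_append)
  qed
  moreover have "{0..<n} - {v} = set ([Suc v..<n] @ [0..<v])"
    using assms by auto
  ultimately show ?thesis
    by (simp add: delete_vertex_def path_union_def cycle_graph_def)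
qed

theorem theorem3p12:
  fixes n :: nat
  assumes "n \<ge> 8" and "n \<noteq> 11"
  shows "\<forall>first. wins forbidden_leaf_move Right first (cycle_graph n)"
proof
  fix first
  have system: "path_system {#xs#} \<longleftrightarrow> length xs \<ge> 2 \<and> distinct xs" for xs :: "nat list"
    by (simp add: path_system_add_mset path_union_def path_system_def[of "{#}"])
  show "wins forbidden_leaf_move Right first (cycle_graph n)"
  proof (cases first)
    case Left
    have "wins forbidden_leaf_move Right Right H" if "forbidden_leaf_move Left (cycle_graph n) H" for H
      using that
    proof cases
      case (Left v)
      then have "v < n" by (simp add: cycle_graph_def)
      let ?xs = "[Suc v..<n] @ [0..<v]"
      \<comment> \<open>The path has order n - 1, which is at least 7, and Right wins moving first
        from order 4 on.\<close>
      have "right_first (image_mset length {#?xs#})"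
        using assms \<open>v < n\<close> single_path[of "n - 1"] by simp
      moreover have "path_system {#?xs#}"
        using assms \<open>v < n\<close> by (auto simp: system)
      ultimately have "wins forbidden_leaf_move Right Right (path_union {#?xs#})"
        by (rule wins_path_union)
      then show ?thesis
        using Left delete_vertex_cycle[of n v] assms \<open>v < n\<close> by simp
    qed
    then show ?thesis
      using wins.opponent_move[of forbidden_leaf_move Right "cycle_graph n"] Left by simp
  next
    case Right
    have path: "path_system {#[0..<n]#}"
      using assms by (simp add: system)
    \<comment> \<open>Here \<open>n\<close> itself must not be exceptional, which is what
      \<open>n \<ge> 8\<close> and \<open>n \<noteq> 11\<close> ensure.\<close>
    have "right_second (image_mset length {#[0..<n]#})"
      using assms single_path[of n] by simp
    then have "wins forbidden_leaf_move Right Left (path_union {#[0..<n]#})"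
      using path by (rule wins_path_union)
    moreover have "forbidden_leaf_move Right (cycle_graph n) (path_union {#[0..<n]#})"
      using forbidden_leaf_move.Right[of "{n - 1, 0}" "cycle_graph n"] assms
        cycle_edges[of n] delete_edge_cycle[of n] not_isolated_path_union[OF path]
      by (auto simp: creates_isolated_def)
    ultimately show ?thesis
      using wins.own_move[of forbidden_leaf_move Right "cycle_graph n"] Right by simp
  qed
qed

end
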